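(* Let $0<\beta<1$ and $q=1/(1-\beta)$. The map $f\mapsto\big(\widetilde{\mathcal{M}}_\beta f\big)'$ is not continuous from $BV(\mathbb{Z})$ to $\ell^q(\mathbb{Z})$, i.e. there is a sequence $\{f_j\}_{j\ge1}\subset BV(\mathbb{Z})$ and a function $f\in BV(\mathbb{Z})$ such that $\|f_j-f\|_{BV(\mathbb{Z})}\to0$ as $j\to\infty$ but $$\big\|\big(\widetilde{\mathcal{M}}_\beta f_j\big)'-\big(\widetilde{\mathcal{M}}_\beta f\big)'\big\|_{\ell^q(\mathbb{Z})}=\mathrm{Var}_q\big(\widetilde{\mathcal{M}}_\beta f_j-\widetilde{\mathcal{M}}_\beta f\big)\not\to0$$ as $j\to\infty$.
   Context: For $g:\mathbb{Z}\to\mathbb{R}$ the discrete derivative is $g'(n)=g(n+1)-g(n)$, the total variation is $\mathrm{Var}(g)=\|g'\|_{\ell^1(\mathbb{Z})}$, and for $1\le q<\infty$ the $q$-variation is $\mathrm{Var}_q(g)=\|g'\|_{\ell^q(\mathbb{Z})}=\big(\sum_{n\in\mathbb{Z}}|g(n+1)-g(n)|^q\big)^{1/q}$. $BV(\mathbb{Z})$ is the space of functions $f:\mathbb{Z}\to\mathbb{R}$ with $\mathrm{Var}(f)<\infty$, with norm $\|f\|_{BV(\mathbb{Z})}=|f(-\infty)|+\mathrm{Var}(f)$, where $f(-\infty)=\lim_{n\to-\infty}f(n)$. The discrete uncentered fractional maximal operator is $$\widetilde{\mathcal{M}}_\beta f(n)=\sup_{r,s\in\mathbb{Z},\;r,s\ge0}\frac{1}{(r+s+1)^{1-\beta}}\sum_{k=-r}^{s}|f(n+k)|.$$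 It is known (Carneiro and Madrid) that if $f\in BV(\mathbb{Z})$ and $\widetilde{\mathcal{M}}_\beta f\not\equiv\infty$ then $\mathrm{Var}_q(\widetilde{\mathcal{M}}_\beta f)\le4^{1/q}\,\mathrm{Var}(f)$. In the displayed identity, the existence of $\mathrm{Var}_q(\widetilde{\mathcal{M}}_\beta f_j-\widetilde{\mathcal{M}}_\beta f)$ includes that $\widetilde{\mathcal{M}}_\beta f_j$ and $\widetilde{\mathcal{M}}_\beta f$ are finite-valued. *)

theory Defs
  imports "HOL-Analysis.Analysis"
begin

definition discrete_deriv :: "(int \<Rightarrow> real) \<Rightarrow> int \<Rightarrow> real" where
  "discrete_deriv g n = g (n + 1) - g n"

definition lq_space :: "real \<Rightarrow> (int \<Rightarrow> real) set" where
  "lq_space q = {g. (\<lambda>n. \<bar>g n\<bar> powr q) summable_on UNIV}"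

text \<open>For a divergent sum \<^const>\<open>infsum\<close> is \<open>0\<close>, so \<open>lq_norm q g\<close> is meaningful only for
  \<open>g \<in> lq_space q\<close>.\<close>

definition lq_norm :: "real \<Rightarrow> (int \<Rightarrow> real) \<Rightarrow> real" where
  "lq_norm q g = (\<Sum>\<^sub>\<infinity>n\<in>UNIV. \<bar>g n\<bar> powr q) powr (1 / q)"

definition q_variation :: "real \<Rightarrow> (int \<Rightarrow> real) \<Rightarrow> real" where
  "q_variation q g = lq_norm q (discrete_deriv g)"

definition total_variation :: "(int \<Rightarrow> real) \<Rightarrow> real" where
  "total_variation g = lq_norm 1 (discrete_deriv g)"

definition BV :: "(int \<Rightarrow> real) set" where
  "BV = {f. discrete_deriv f \<in> lq_space 1}"

text \<open>The limit at \<open>-\<infinity>\<close> exists for every \<open>f \<in> BV\<close>, since \<open>discrete_deriv f\<close> is then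
  absolutely summable.\<close>

definition BV_norm :: "(int \<Rightarrow> real) \<Rightarrow> real" where
  "BV_norm f = \<bar>Lim at_bot f\<bar> + total_variation f"

text \<open>The supremum may be infinite, so it is taken in the extended nonnegative reals.\<close>

definition frac_max_ennreal :: "real \<Rightarrow> (int \<Rightarrow> real) \<Rightarrow> int \<Rightarrow> ennreal" where
  "frac_max_ennreal \<beta> f n =
     (SUP (r, s) \<in> (UNIV :: (nat \<times> nat) set).
        ennreal (1 / real (r + s + 1) powr (1 - \<beta>) * (\<Sum>k = - int r..int s. \<bar>f (n + k)\<bar>)))"

definition frac_max_finite :: "real \<Rightarrow> (int \<Rightarrow> real) \<Rightarrow> bool" where
  "frac_max_finite \<beta> f \<longleftrightarrow> (\<forall>n. frac_max_ennreal \<beta> f n < \<infinity>)"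

text \<open>Since \<^const>\<open>enn2real\<close> maps \<open>\<infinity>\<close> to \<open>0\<close>, the real-valued version represents the maximal
  function only under \<open>frac_max_finite \<beta> f\<close>.\<close>

definition frac_max :: "real \<Rightarrow> (int \<Rightarrow> real) \<Rightarrow> int \<Rightarrow> real" where
  "frac_max \<beta> f n = enn2real (frac_max_ennreal \<beta> f n)"

end

theory Submission
  imports Defs
begin

text \<open>Take \<open>f = \<delta>\<^sub>0\<close> and add to it a plateau of height \<open>\<epsilon>\<close> on \<open>{-w..w}\<close>. The plateau
  has variation \<open>2\<epsilon>\<close>, but once \<open>\<epsilon> (w+1) powr \<beta> \<ge> 1 + \<epsilon>\<close> the averages over \<open>{0..w}\<close> beat the spike at
  \<open>0\<close>. Hence the perturbed maximal function does not drop from \<open>0\<close> to \<open>1\<close>, whereas that of \<open>\<delta>\<^sub>0\<close>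
  drops by at least \<open>1 - 2 powr (\<beta> - 1)\<close>. All functions have finite support, so their maximal functions
  are eventually monotone on both sides and have finite variation.\<close>

section \<open>Interval averages and their supremum\<close>

text \<open>Intervals are given by endpoints instead of radii around a centre, so that one average
  can be used at every point of its interval and compared between neighbouring points.\<close>

definition frac_avg :: "real \<Rightarrow> (int \<Rightarrow> real) \<Rightarrow> int \<Rightarrow> int \<Rightarrow> real" where
  "frac_avg \<beta> f a b = (\<Sum>k=a..b. \<bar>f k\<bar>) / real_of_int (b - a + 1) powr (1 - \<beta>)"

lemma frac_avg_shift:
  "1 / real (r + s + 1) powr (1 - \<beta>) * (\<Sum>k = - int r..int s. \<bar>f (n + k)\<bar>)
     = frac_avg \<beta> f (n - int r) (n + int s)"
proof -
  have "(\<Sum>k = - int r..int s. \<bar>f (n + k)\<bar>) = (\<Sum>k = n - int r..n + int s. \<bar>f k\<bar>)"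
    by (rule sum.reindex_bij_witness[of _ "\<lambda>k. k - n" "\<lambda>k. n + k"]) auto
  then show ?thesis
    by (simp add: frac_avg_def add_ac)
qed

lemma frac_max_ennreal_le:
  assumes "\<And>a b. a \<le> n \<Longrightarrow> n \<le> b \<Longrightarrow> frac_avg \<beta> f a b \<le> C"
  shows "frac_max_ennreal \<beta> f n \<le> ennreal C"
  unfolding frac_max_ennreal_def frac_avg_shift
  by (rule SUP_least) (auto intro!: ennreal_leI assms)

lemma frac_max_le:
  assumes "\<And>a b. a \<le> n \<Longrightarrow> n \<le> b \<Longrightarrow> frac_avg \<beta> f a b \<le> C" "0 \<le> C"
  shows "frac_max \<beta> f n \<le> C"
  unfolding frac_max_def
  using enn2real_mono[OF frac_max_ennreal_le[of n \<beta> f C]] assms by simp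

lemma frac_max_nonneg: "0 \<le> frac_max \<beta> f n"
  by (simp add: frac_max_def)

text \<open>Finiteness is essential: at an infinite value \<open>enn2real\<close> returns 0, and
  \<open>frac_max\<close> would bound no positive average.\<close>

lemma frac_avg_le_frac_max:
  assumes "frac_max_finite \<beta> f" "a \<le> n" "n \<le> b"
  shows "frac_avg \<beta> f a b \<le> frac_max \<beta> f n"
proof -
  have "ennreal (frac_avg \<beta> f (n - int (nat (n - a))) (n + int (nat (b - n))))
      \<le> frac_max_ennreal \<beta> f n"
    unfolding frac_max_ennreal_def frac_avg_shift
    by (rule SUP_upper2[of "(nat (n - a), nat (b - n))"]) auto
  moreover have "frac_max_ennreal \<beta> f n = ennreal (frac_max \<beta> f n)"
    using assms(1) by (simp add: frac_max_def frac_max_finite_def)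
  ultimately show ?thesis
    using assms(2,3) by (simp add: ennreal_le_iff frac_max_nonneg)
qed

section \<open>Maximal functions of finitely supported functions\<close>

text \<open>The length is at least 1 and the exponent 1 - \<beta> is positive, so the denominator is
  at least 1. The bound is uniform in the interval, which makes the supremum finite.\<close>

lemma frac_avg_le_sum:
  assumes "\<beta> < 1" "\<And>k. N < \<bar>k\<bar> \<Longrightarrow> f k = 0" "a \<le> b"
  shows "frac_avg \<beta> f a b \<le> (\<Sum>k=-N..N. \<bar>f k\<bar>)"
proof -
  have "(\<Sum>k=a..b. \<bar>f k\<bar>) = (\<Sum>k\<in>{a..b} \<inter> {-N..N}. \<bar>f k\<bar>)"
    using assms(2) by (intro sum.mono_neutral_right) force+
  also have "\<dots> \<le> (\<Sum>k=-N..N. \<bar>f k\<bar>)"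
    by (intro sum_mono2) auto
  finally have 1: "(\<Sum>k=a..b. \<bar>f k\<bar>) \<le> (\<Sum>k=-N..N. \<bar>f k\<bar>)" .
  have "1 \<le> real_of_int (b - a + 1) powr (1 - \<beta>)"
    using assms by (intro ge_one_powr_ge_zero) auto
  then have "frac_avg \<beta> f a b \<le> (\<Sum>k=a..b. \<bar>f k\<bar>)"
    unfolding frac_avg_def
    using frac_le[of "\<Sum>k=a..b. \<bar>f k\<bar>" "\<Sum>k=a..b. \<bar>f k\<bar>" 1] by (simp add: sum_nonneg)
  with 1 show ?thesis by linarith
qed

lemma frac_max_finite_if_finite_support:
  assumes "\<beta> < 1" "\<And>k. N < \<bar>k\<bar> \<Longrightarrow> f k = 0"
  shows "frac_max_finite \<beta> f"
  unfolding frac_max_finite_def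
proof
  fix n
  have "frac_max_ennreal \<beta> f n \<le> ennreal (\<Sum>k=-N..N. \<bar>f k\<bar>)"
    by (intro frac_max_ennreal_le frac_avg_le_sum assms) auto
  then show "frac_max_ennreal \<beta> f n < \<infinity>"
    by (simp add: order_le_less_trans)
qed

text \<open>An interval through \<open>m\<close> that misses \<open>n\<close> also misses the support.\<close>

lemma frac_max_mono_away_from_support:
  assumes "frac_max_finite \<beta> f" "\<And>k. N < \<bar>k\<bar> \<Longrightarrow> f k = 0"
    and "N \<le> n \<and> n \<le> m \<or> m \<le> n \<and> n \<le> - N"
  shows "frac_max \<beta> f m \<le> frac_max \<beta> f n"
proof (rule frac_max_le[OF _ frac_max_nonneg])
  fix a b assume ab: "a \<le> m" "m \<le> b"
  show "frac_avg \<beta> f a b \<le> frac_max \<beta> f n"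
  proof (cases "a \<le> n \<and> n \<le> b")
    case True
    then show ?thesis using frac_avg_le_frac_max assms(1) by blast
  next
    case False
    then have "\<forall>k\<in>{a..b}. f k = 0"
      using assms(2,3) ab by (intro ballI assms(2)) auto
    then have "frac_avg \<beta> f a b = 0"
      by (simp add: frac_avg_def)
    then show ?thesis by (simp add: frac_max_nonneg)
  qed
qed

text \<open>The differences telescope, and nonnegativity of \<open>g\<close> bounds every partial
  sum by \<open>g N\<close>.\<close>

lemma summable_on_antimono_differences:
  fixes g :: "int \<Rightarrow> real"
  assumes "\<And>n. 0 \<le> g n" "\<And>n. N \<le> n \<Longrightarrow> g (n + 1) \<le> g n"
  shows "(\<lambda>n. \<bar>g (n + 1) - g n\<bar>) summable_on {N..}"
proof -
  have nonneg: "0 \<le> g (N + int k) - g (N + int (Suc k))" for k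
    using assms(2)[of "N + int k"] by (simp add: add_ac)
  have "(\<Sum>k<m. g (N + int k) - g (N + int (Suc k))) = g N - g (N + int m)" for m
    by (induction m) auto
  then have "(\<Sum>k<m. g (N + int k) - g (N + int (Suc k))) \<le> g N" for m
    using assms(1) by simp
  then have "summable (\<lambda>k. g (N + int k) - g (N + int (Suc k)))"
    using nonneg by (intro summableI_nonneg_bounded) auto
  then have "(\<lambda>k. g (N + int k) - g (N + int (Suc k))) summable_on UNIV"
    using nonneg by (intro summable_nonneg_imp_summable_on) auto
  also have "(\<lambda>k. g (N + int k) - g (N + int (Suc k)))
      = (\<lambda>n. \<bar>g (n + 1) - g n\<bar>) \<circ> (\<lambda>k. N + int k)"
    using nonneg by (auto simp: fun_eq_iff add_ac abs_minus_commute)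
  finally have "(\<lambda>n. \<bar>g (n + 1) - g n\<bar>) summable_on range (\<lambda>k. N + int k)"
    by (subst summable_on_reindex) (auto simp: inj_on_def o_def)
  also have "range (\<lambda>k. N + int k) = {N..}"
    by (auto simp: image_iff intro!: exI[of _ "nat (_ - N)"])
  finally show ?thesis .
qed

lemma summable_on_deriv_frac_max:
  assumes "\<beta> < 1" "\<And>k. N < \<bar>k\<bar> \<Longrightarrow> f k = 0"
  shows "(\<lambda>n. \<bar>discrete_deriv (frac_max \<beta> f) n\<bar>) summable_on UNIV"
proof -
  let ?M = "frac_max \<beta> f"
  have fin: "frac_max_finite \<beta> f"
    by (rule frac_max_finite_if_finite_support[OF assms])
  note mono = frac_max_mono_away_from_support[OF fin assms(2)]
  have right: "(\<lambda>n. \<bar>discrete_deriv ?M n\<bar>) summable_on {N..}"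
    unfolding discrete_deriv_def
    by (rule summable_on_antimono_differences) (auto intro: frac_max_nonneg mono)
  \<comment> \<open>Reflected by n to -n, the left tail is nonincreasing from \<open>N\<close> on.
    The step from -n to -(n + 1) is, up to sign, the derivative at -n - 1.\<close>
  have "(\<lambda>n. \<bar>?M (- (n + 1)) - ?M (- n)\<bar>) summable_on {N..}"
    by (rule summable_on_antimono_differences) (auto intro: frac_max_nonneg mono)
  also have "(\<lambda>n. \<bar>?M (- (n + 1)) - ?M (- n)\<bar>)
      = (\<lambda>n. \<bar>discrete_deriv ?M n\<bar>) \<circ> (\<lambda>n. - n - 1)"
    by (auto simp: fun_eq_iff discrete_deriv_def abs_minus_commute)
  finally have "(\<lambda>n. \<bar>discrete_deriv ?M n\<bar>) summable_on (\<lambda>n. - n - 1) ` {N..}"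
    by (subst summable_on_reindex) (auto simp: inj_on_def o_def)
  also have "(\<lambda>n. - n - 1) ` {N..} = {.. - N - 1}"
    by (auto simp: image_iff intro!: bexI[of _ "- _ - 1"])
  finally have left: "(\<lambda>n. \<bar>discrete_deriv ?M n\<bar>) summable_on {.. - N - 1}" .
  have "(\<lambda>n. \<bar>discrete_deriv ?M n\<bar>) summable_on ({.. - N - 1} \<union> {- N..<N}) \<union> {N..}"
    by (intro summable_on_union[OF summable_on_union[OF left] right] summable_on_finite) auto
  also have "({.. - N - 1} \<union> {- N..<N}) \<union> {N..} = (UNIV :: int set)"
    by auto
  finally show ?thesis .
qed

section \<open>Membership in \<open>lq_space\<close> and \<open>BV\<close>\<close>

text \<open>The total \<open>B\<close> dominates each single term, so one factor is kept for
  summability and the remaining power q - 1 is bounded by that of \<open>B\<close>.\<close>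

lemma lq_space_if_abs_summable:
  assumes "(\<lambda>n. \<bar>g n\<bar>) summable_on UNIV" "1 \<le> q"
  shows "g \<in> lq_space q"
proof -
  define B where "B = (\<Sum>\<^sub>\<infinity>n. \<bar>g n\<bar>)"
  have B: "\<bar>g n\<bar> \<le> B" for n
    using finite_sum_le_infsum[OF assms(1), of "{n}"] by (simp add: B_def)
  have "\<bar>g n\<bar> powr q \<le> B powr (q - 1) * \<bar>g n\<bar>" for n
  proof -
    have "\<bar>g n\<bar> powr q = \<bar>g n\<bar> powr (q - 1) * \<bar>g n\<bar>"
      using powr_add[of "\<bar>g n\<bar>" "q - 1" 1] by simp
    also have "\<dots> \<le> B powr (q - 1) * \<bar>g n\<bar>"
      using assms(2) B by (intro mult_right_mono powr_mono2) auto
    finally show ?thesis .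
  qed
  then show ?thesis
    unfolding lq_space_def
    by (auto intro!: summable_on_comparison_test[OF summable_on_cmult_right[OF assms(1)]])
qed

text \<open>A single summand never exceeds the whole series, so one large value bounds the norm from
  below. Membership rules out the default value 0 of a divergent sum.\<close>

lemma abs_le_lq_norm:
  assumes "g \<in> lq_space q" "0 < q"
  shows "\<bar>g n\<bar> \<le> lq_norm q g"
proof -
  have "\<bar>g n\<bar> powr q \<le> (\<Sum>\<^sub>\<infinity>n. \<bar>g n\<bar> powr q)"
    using finite_sum_le_infsum[of "\<lambda>n. \<bar>g n\<bar> powr q" UNIV "{n}"] assms(1)
    by (simp add: lq_space_def)
  then have "(\<bar>g n\<bar> powr q) powr (1 / q) \<le> lq_norm q g"
    unfolding lq_norm_def using assms(2) by (intro powr_mono2) auto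
  then show ?thesis using assms(2) by (simp add: powr_powr)
qed

lemma BV_if_finite_support:
  assumes "\<And>k. N < \<bar>k\<bar> \<Longrightarrow> f k = 0"
  shows "f \<in> BV"
proof -
  \<comment> \<open>The block begins at -N - 1 because the difference there already reads
    \<open>f\<close> at -N.\<close>
  have "(\<lambda>n. \<bar>discrete_deriv f n\<bar> powr 1) summable_on {- N - 1..N}"
    by (intro summable_on_finite) auto
  moreover have "(\<lambda>n. \<bar>discrete_deriv f n\<bar> powr 1) summable_on UNIV \<longleftrightarrow>
      (\<lambda>n. \<bar>discrete_deriv f n\<bar> powr 1) summable_on {- N - 1..N}"
    by (rule summable_on_cong_neutral) (auto simp: discrete_deriv_def assms)
  ultimately show ?thesis
    by (simp add: BV_def lq_space_def)
qed

section \<open>The spike and the plateaus\<close>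

definition spike :: "int \<Rightarrow> real" where
  "spike n = (if n = 0 then 1 else 0)"

definition plateau :: "real \<Rightarrow> nat \<Rightarrow> int \<Rightarrow> real" where
  "plateau \<epsilon> w n = (if \<bar>n\<bar> \<le> int w then \<epsilon> else 0)"

text \<open>The plateau vanishes near -\<infinity> and only jumps up after -w - 1 and down after w.
  The norm is independent of \<open>w\<close>, which leaves the width free to be chosen
  large.\<close>

lemma BV_norm_plateau:
  assumes "0 \<le> \<epsilon>"
  shows "BV_norm (plateau \<epsilon> w) = 2 * \<epsilon>"
proof -
  have "eventually (\<lambda>n. plateau \<epsilon> w n = 0) at_bot"
    using eventually_le_at_bot[of "- int w - 1"]
    by eventually_elim (auto simp: plateau_def)
  then have "(plateau \<epsilon> w \<longlongrightarrow> 0) at_bot"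
    by (rule tendsto_eventually)
  then have lim: "Lim at_bot (plateau \<epsilon> w) = 0"
    by (intro tendsto_Lim) (auto simp: trivial_limit_at_bot_linorder)
  have "(\<Sum>\<^sub>\<infinity>n. \<bar>discrete_deriv (plateau \<epsilon> w) n\<bar> powr 1)
      = (\<Sum>\<^sub>\<infinity>n\<in>{- int w - 1, int w}. \<bar>discrete_deriv (plateau \<epsilon> w) n\<bar> powr 1)"
    by (rule infsum_cong_neutral) (auto simp: discrete_deriv_def plateau_def)
  also have "\<dots> = 2 * \<epsilon>"
    using assms by (simp add: discrete_deriv_def plateau_def)
  finally show ?thesis
    using assms lim by (simp add: BV_norm_def total_variation_def lq_norm_def)
qed

text \<open>An interval through 1 either misses the spike or contains both 0 and 1, hence has length
  at least 2. At 0 the singleton {0} already gives 1.\<close>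

lemma deriv_frac_max_spike_le:
  assumes "\<beta> < 1"
  shows "discrete_deriv (frac_max \<beta> spike) 0 \<le> 2 powr (\<beta> - 1) - 1"
proof -
  have "frac_max_finite \<beta> spike"
    by (rule frac_max_finite_if_finite_support[OF assms, of 0]) (auto simp: spike_def)
  then have "frac_avg \<beta> spike 0 0 \<le> frac_max \<beta> spike 0"
    by (rule frac_avg_le_frac_max) auto
  then have "1 \<le> frac_max \<beta> spike 0"
    by (simp add: frac_avg_def spike_def)
  moreover have "frac_max \<beta> spike 1 \<le> 2 powr (\<beta> - 1)"
  proof (rule frac_max_le)
    fix a b :: int assume ab: "a \<le> 1" "1 \<le> b"
    show "frac_avg \<beta> spike a b \<le> 2 powr (\<beta> - 1)"
    proof (cases "a \<le> 0")
      case True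
      with ab have "frac_avg \<beta> spike a b = real_of_int (b - a + 1) powr (\<beta> - 1)"
        using powr_minus_divide[of "real_of_int (b - a + 1)" "1 - \<beta>"]
        by (simp add: frac_avg_def spike_def if_distrib cong: if_cong)
      \<comment> \<open>The exponent is negative, so the shortest admissible interval gives the
        largest average.\<close>
      also have "\<dots> \<le> 2 powr (\<beta> - 1)"
        using True ab assms by (intro powr_mono2') auto
      finally show ?thesis .
    next
      case False
      then show ?thesis by (simp add: frac_avg_def spike_def)
    qed
  qed simp
  ultimately show ?thesis
    by (simp add: discrete_deriv_def)
qed

text \<open>This trades an interval ending at 0 for its mirror image starting at 0.\<close>

lemma frac_avg_uminus:
  assumes "\<And>k. f (- k) = f k"
  shows "frac_avg \<beta> f (- b) (- a) = frac_avg \<beta> f a b"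
proof -
  have "(\<Sum>k=-b..-a. \<bar>f k\<bar>) = (\<Sum>k=a..b. \<bar>f k\<bar>)"
    by (rule sum.reindex_bij_witness[of _ uminus uminus]) (auto simp: assms)
  then show ?thesis by (simp add: frac_avg_def)
qed

text \<open>An interval through \<open>0\<close> that misses \<open>1\<close> is mirrored to one through \<open>1\<close>, except for the
  singleton \<open>{0}\<close>, which is beaten by \<open>{0..w}\<close>.\<close>

lemma deriv_frac_max_spike_plateau_nonneg:
  fixes \<epsilon> \<beta> :: real and w :: nat
  defines "f \<equiv> \<lambda>n. spike n + plateau \<epsilon> w n"
  assumes "\<beta> < 1" "0 \<le> \<epsilon>" "1 \<le> w" and w: "1 + \<epsilon> \<le> \<epsilon> * real (w + 1) powr \<beta>"
  shows "0 \<le> discrete_deriv (frac_max \<beta> f) 0"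
proof -
  have fin: "frac_max_finite \<beta> f"
    by (rule frac_max_finite_if_finite_support[OF assms(2), of "int w"])
       (auto simp: f_def spike_def plateau_def)
  have sym: "f (- k) = f k" for k
    by (simp add: f_def spike_def plateau_def)
  have "frac_max \<beta> f 0 \<le> frac_max \<beta> f 1"
  proof (rule frac_max_le[OF _ frac_max_nonneg])
    fix a b :: int assume ab: "a \<le> 0" "0 \<le> b"
    consider "1 \<le> b" | "b = 0" "a \<le> -1" | "b = 0" "a = 0"
      using ab by linarith
    then show "frac_avg \<beta> f a b \<le> frac_max \<beta> f 1"
    proof cases
      case 1
      then show ?thesis using ab by (intro frac_avg_le_frac_max fin) auto
    next
      case 2
      then have "frac_avg \<beta> f (- b) (- a) \<le> frac_max \<beta> f 1"
        by (intro frac_avg_le_frac_max fin) auto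
      then show ?thesis by (simp add: frac_avg_uminus[of f, OF sym])
    next
      case 3
      have "\<epsilon> * real (w + 1) = (\<Sum>k=0..int w. \<epsilon>)"
        by simp
      also have "\<dots> \<le> (\<Sum>k=0..int w. \<bar>f k\<bar>)"
        using assms(3) by (intro sum_mono) (auto simp: f_def spike_def plateau_def)
      finally have sum: "\<epsilon> * real (w + 1) \<le> (\<Sum>k=0..int w. \<bar>f k\<bar>)" .
      have "frac_avg \<beta> f a b = 1 + \<epsilon>"
        using 3 assms(3) by (simp add: frac_avg_def f_def spike_def plateau_def)
      also note w
      \<comment> \<open>The mass of w + 1 points exceeds the fractional denominator by exactly the
        factor in the hypothesis on \<open>w\<close>.\<close>
      also have "\<epsilon> * real (w + 1) powr \<beta> = \<epsilon> * real (w + 1) / real (w + 1) powr (1 - \<beta>)"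
        using powr_diff[of "real (w + 1)" 1 "1 - \<beta>"] by simp
      also have "\<dots> \<le> frac_avg \<beta> f 0 (int w)"
        using divide_right_mono[OF sum, of "real (w + 1) powr (1 - \<beta>)"]
        by (simp add: frac_avg_def add_ac)
      also have "\<dots> \<le> frac_max \<beta> f 1"
        using assms(4) by (intro frac_avg_le_frac_max fin) auto
      finally show ?thesis .
    qed
  qed
  then show ?thesis by (simp add: discrete_deriv_def)
qed

text \<open>Since \<beta> is positive, the power of w + 1 is unbounded, so even a very low plateau
  wins once it is wide enough.\<close>

lemma ex_plateau_width:
  fixes \<epsilon> \<beta> :: real
  assumes "0 < \<beta>" "0 < \<epsilon>"
  shows "\<exists>w\<ge>1. 1 + \<epsilon> \<le> \<epsilon> * real (w + 1) powr \<beta>"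
proof -
  \<comment> \<open>The bound solves x powr \<beta> = (1 + \<epsilon>) / \<epsilon> for x;
    \<open>max 1 w\<close> below also secures width at least 1.\<close>
  obtain w :: nat where w: "((1 + \<epsilon>) / \<epsilon>) powr (1 / \<beta>) \<le> real w"
    using real_arch_simple by blast
  have "(1 + \<epsilon>) / \<epsilon> = (((1 + \<epsilon>) / \<epsilon>) powr (1 / \<beta>)) powr \<beta>"
    using assms by (simp add: powr_powr)
  also have "\<dots> \<le> real (max 1 w + 1) powr \<beta>"
    using assms w by (intro powr_mono2) auto
  finally have "1 + \<epsilon> \<le> \<epsilon> * real (max 1 w + 1) powr \<beta>"
    using assms by (simp add: field_simps)
  then show ?thesis by (intro exI[of _ "max 1 w"]) auto
qed

section \<open>Discontinuity at the spike along ever lower plateaus\<close>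

theorem theorem5:
  fixes \<beta> q :: real
  assumes "0 < \<beta>" and "\<beta> < 1" and "q = 1 / (1 - \<beta>)"
  shows "\<exists>(F :: nat \<Rightarrow> int \<Rightarrow> real) (f :: int \<Rightarrow> real).
    f \<in> BV \<and> (\<forall>j\<ge>1. F j \<in> BV) \<and>
    frac_max_finite \<beta> f \<and> (\<forall>j\<ge>1. frac_max_finite \<beta> (F j)) \<and>
    discrete_deriv (frac_max \<beta> f) \<in> lq_space q \<and>
    (\<forall>j\<ge>1. discrete_deriv (frac_max \<beta> (F j)) \<in> lq_space q) \<and>
    (\<lambda>j. BV_norm (\<lambda>n. F j n - f n)) \<longlonglongrightarrow> 0 \<and>
    (\<forall>j\<ge>1. lq_norm q (\<lambda>n. discrete_deriv (frac_max \<beta> (F j)) n - discrete_deriv (frac_max \<beta> f) n)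
           = q_variation q (\<lambda>n. frac_max \<beta> (F j) n - frac_max \<beta> f n)) \<and>
    \<not> (\<lambda>j. lq_norm q (\<lambda>n. discrete_deriv (frac_max \<beta> (F j)) n - discrete_deriv (frac_max \<beta> f) n))
        \<longlonglongrightarrow> 0"
proof -
  have q: "1 \<le> q"
    using assms by simp
  define \<epsilon> where "\<epsilon> j = inverse (real (Suc j))" for j
  have \<epsilon>: "0 < \<epsilon> j" for j
    by (simp add: \<epsilon>_def)
  obtain w where w: "1 \<le> w j" "1 + \<epsilon> j \<le> \<epsilon> j * real (w j + 1) powr \<beta>" for j
    using ex_plateau_width[OF assms(1) \<epsilon>] by metis
  define F where "F j n = spike n + plateau (\<epsilon> j) (w j) n" for j n
  let ?D = "\<lambda>g. discrete_deriv (frac_max \<beta> g)"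
  let ?d = "\<lambda>j n. ?D (F j) n - ?D spike n"
  have supp_spike: "spike k = 0" if "0 < \<bar>k\<bar>" for k
    using that by (simp add: spike_def)
  have supp_F: "F j k = 0" if "int (w j) < \<bar>k\<bar>" for j k
    using that by (auto simp: F_def spike_def plateau_def)
  note summable_spike = summable_on_deriv_frac_max[OF assms(2) supp_spike]
  note summable_F = summable_on_deriv_frac_max[OF assms(2) supp_F]
  \<comment> \<open>Both derivatives are absolutely summable, hence so is their difference; this
    makes its norm a genuine one.\<close>
  have diff_lq: "?d j \<in> lq_space q" for j
  proof (rule lq_space_if_abs_summable[OF _ q])
    show "(\<lambda>n. \<bar>?d j n\<bar>) summable_on UNIV"
      by (rule summable_on_comparison_test[OF summable_on_add[OF summable_F summable_spike]])
         (auto intro: abs_triangle_ineq4)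
  qed
  have lower: "1 - 2 powr (\<beta> - 1) \<le> lq_norm q (?d j)" for j
  proof -
    have "0 \<le> ?D (F j) 0"
      unfolding F_def
      using deriv_frac_max_spike_plateau_nonneg[OF assms(2) less_imp_le[OF \<epsilon>] w] .
    \<comment> \<open>The perturbed derivative at 0 is nonnegative while that of the spike is
      bounded away from 0 below, by a gap that does not depend on \<open>j\<close>.\<close>
    then have "1 - 2 powr (\<beta> - 1) \<le> \<bar>?d j 0\<bar>"
      using deriv_frac_max_spike_le[OF assms(2)] by linarith
    also have "\<dots> \<le> lq_norm q (?d j)"
      using abs_le_lq_norm[OF diff_lq[of j], of 0] q by simp
    finally show ?thesis .
  qed
  have not_lim: "\<not> (\<lambda>j. lq_norm q (?d j)) \<longlonglongrightarrow> 0"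
  proof
    assume "(\<lambda>j. lq_norm q (?d j)) \<longlonglongrightarrow> 0"
    then have "1 - 2 powr (\<beta> - 1) \<le> 0"
      by (rule LIMSEQ_le_const) (use lower in auto)
    \<comment> \<open>The gap is strictly positive because \<beta> < 1.\<close>
    moreover have "2 powr (\<beta> - 1) < (2::real) powr 0"
      using assms(2) by (intro powr_less_mono) auto
    ultimately show False by simp
  qed
  have "(\<lambda>n. F j n - spike n) = plateau (\<epsilon> j) (w j)" for j
    by (simp add: F_def fun_eq_iff)
  then have "BV_norm (\<lambda>n. F j n - spike n) = 2 * \<epsilon> j" for j
    using BV_norm_plateau \<epsilon> less_imp_le by metis
  moreover have "(\<lambda>j. 2 * \<epsilon> j) \<longlonglongrightarrow> 0"
    unfolding \<epsilon>_def using tendsto_mult_left[OF LIMSEQ_inverse_real_of_nat, of 2] by simp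
  ultimately have lim: "(\<lambda>j. BV_norm (\<lambda>n. F j n - spike n)) \<longlonglongrightarrow> 0"
    by simp
  have "lq_norm q (?d j) = q_variation q (\<lambda>n. frac_max \<beta> (F j) n - frac_max \<beta> spike n)" for j
    unfolding q_variation_def by (rule arg_cong[of _ _ "lq_norm q"]) (simp add: discrete_deriv_def fun_eq_iff)
  then show ?thesis
    using not_lim lim BV_if_finite_support[OF supp_spike] BV_if_finite_support[OF supp_F]
      frac_max_finite_if_finite_support[OF assms(2) supp_spike]
      frac_max_finite_if_finite_support[OF assms(2) supp_F]
      lq_space_if_abs_summable[OF summable_spike q] lq_space_if_abs_summable[OF summable_F q]
    by (intro exI[of _ F] exI[of _ spike] conjI allI impI)
qed

end
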